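(* Let $(g^*,u^*,x^* )$ be an optimal solution of the economic dispatch problem $$\min_{g,u\in\mathbb{R}^T,\;x\in\mathbb{R}^{T+1}}\ \alpha_g g^Tg+\beta_g\mathbf 1^Tg+C_s(x)\quad\text{s.t.}\quad \underline g\le g_t\le\overline g\ (t=1,\dots,T),\quad (u,x)\in\mathcal S,\quad D+u=g,$$ and let $\lambda^*\in\mathbb{R}^T$ be an optimal dual variable associated with the power balance constraint $D+u=g$, where the storage cycling cost is $$C_s(x)=\frac{\alpha_bBE}{2}\,x^TM(x)M(x)^Tx .$$ Assume that $C_s$ is differentiable in a small neighbourhood of $x^*$, and that all inequality constraints ($\underline g\le g_t\le\overline g$, $0\le x_t\le 1$, $\underline u\le u_t\le\overline u$) are satisfied strictly at the optimum. If the matrix $M(x^* )\in\mathbb{R}^{(T+1)\times T}$ has rank $T$, then the storage subproblem $$\max_{u,x}\ -p^Tu-C_s(x)\quad\text{s.t.}\quad (u,x)\in\mathcal S$$ with prices $p=\lambda^*$ has a unique solution.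
   Context: Setting. $T\ge1$ is an integer; $\alpha_g,\beta_g>0$; $\underline g\le\overline g$ are reals; $D\in\mathbb{R}^T$ is a fixed demand; $E>0$ is the storage capacity; $\underline u\le\overline u$ are reals; $x_o\in[0,1]$; $B>0$; $\alpha_b>0$. Vectors in $\mathbb{R}^{T+1}$ are indexed $x=(x_0,\dots,x_T)$. $\mathbf 1$ is the all-ones vector. $\mathcal S$ is the set of $(u,x)\in\mathbb{R}^T\times\mathbb{R}^{T+1}$ with $0\le x_t\le1$ for $t=0,\dots,T$; $\underline u\le u_t\le\overline u$ and $x_t=x_{t-1}+u_t/E$ for $t=1,\dots,T$; and $x_0=x_T=x_o$. "Optimal dual variable": $\lambda^*$ maximizes $\mathcal D(\lambda)=\min\{\alpha_g g^Tg+\beta_g\mathbf 1^Tg+C_s(x)+\lambda^T(D+u-g):\underline g\le g_t\le\overline g\ \forall t,\ (u,x)\in\mathcal S\}$ over $\lambda\in\mathbb{R}^T$. The matrix $M(x)$ (Rainflow incidence matrix). For a finite set $S$ of time indices, $S[j]$ is its $j$-th smallest element and $x_S(j)=x_{S[j]}$. Let $\mathrm{dir}(x,S,j)=(S[j+1],S[j])$ if $x_S(j+1)\ge x_S(j)$, and $(S[j],S[j+1])$ otherwise. Given $x\in\mathbb{R}^{T+1}$: (1) $S_r$ consists of $0$, $T$, and all $t\in\{1,\dots,T-1\}$ at which $x$ changes direction, i.e. $x_t\ne x_{t-1}$ and the first nonzero increment $x_{s+1}-x_s$ with $s\ge t$ exists and has sign opposite to $x_t-x_{t-1}$. Set $S_f=\emptyset$.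 (2) While $|S_r|>3$ and there is $j\in\{2,\dots,|S_r|-2\}$ with $\Delta_{j-1}\ge\Delta_j$ and $\Delta_{j+1}\ge\Delta_j$, where $\Delta_i=|x_{S_r}(i+1)-x_{S_r}(i)|$, take the smallest such $j$, add the ordered pair $\mathrm{dir}(x,S_r,j)$ to $S_f$, and then remove $S_r[j],S_r[j+1]$ from $S_r$. (3) Let $\mathcal G(x)$ be the directed multigraph on nodes $\{0,\dots,T\}$ whose edges are: each pair in $S_f$, taken twice; and the edges $\mathrm{dir}(x,S_r,j)$, $j=1,\dots,|S_r|-1$, for the final $S_r$. $M(x)\in\mathbb{R}^{(T+1)\times T}$ has rows indexed by nodes and one column per edge, in the order in which the edges are added, with $+1$ at the first node of the edge and $-1$ at the second node and $0$ elsewhere, followed by zero columns so that there are $T$ columns in total. Thus $M(x)^Tx$ is the vector of half-cycle depths. *)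

theory Defs
  imports "HOL-Analysis.Analysis" "HOL-Library.Infinite_Set"
begin

text \<open>
  The horizon is \<open>T = CARD('n)\<close> for a finite linearly ordered index type \<open>'n\<close>. Vectors in
  \<open>\<real>\<^sup>T\<close> have type \<open>real ^ 'n\<close>, the elements of \<open>'n\<close> in increasing order standing for the times
  \<open>1, \<dots>, T\<close>. Vectors in \<open>\<real>\<^sup>T\<^sup>+\<^sup>1\<close> have type \<open>real ^ ('n option)\<close>, where \<open>None\<close> stands for time \<open>0\<close>
  and \<open>Some s\<close> for the time of \<open>s\<close>.
\<close>

definition step :: "nat \<Rightarrow> 'n::{finite,linorder}" where
  "step t = sorted_list_of_set UNIV ! (t - 1)"

definition node :: "nat \<Rightarrow> ('n::{finite,linorder}) option" where
  "node t = (if t = 0 then None else Some (step t))"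

definition traj :: "real ^ (('n::{finite,linorder}) option) \<Rightarrow> nat \<Rightarrow> real" where
  "traj x t = x $ node t"

text \<open>
  The rainflow procedure works on a sequence \<open>x :: nat \<Rightarrow> real\<close>, of which only the values at
  \<open>0, \<dots>, T\<close> are used. The positions \<open>j\<close> below are counted from \<open>1\<close>, whereas
  \<^const>\<open>enumerate\<close> counts from \<open>0\<close>.
\<close>

definition elt :: "nat set \<Rightarrow> nat \<Rightarrow> nat" where
  "elt S j = enumerate S (j - 1)"

definition dir :: "(nat \<Rightarrow> real) \<Rightarrow> nat set \<Rightarrow> nat \<Rightarrow> nat \<times> nat" where
  "dir x S j =
    (if x (elt S (j + 1)) \<ge> x (elt S j) then (elt S (j + 1), elt S j) else (elt S j, elt S (j + 1)))"

definition depth :: "(nat \<Rightarrow> real) \<Rightarrow> nat set \<Rightarrow> nat \<Rightarrow> real" where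
  "depth x S i = \<bar>x (elt S (i + 1)) - x (elt S i)\<bar>"

definition turning_points :: "nat \<Rightarrow> (nat \<Rightarrow> real) \<Rightarrow> nat set" where
  "turning_points T x = {0, T} \<union>
    {t \<in> {1..T - 1}. x t \<noteq> x (t - 1) \<and>
      (\<exists>s\<in>{t..<T}. x (s + 1) \<noteq> x s \<and> (\<forall>r\<in>{t..<s}. x (r + 1) = x r) \<and>
         sgn (x (s + 1) - x s) = - sgn (x t - x (t - 1)))}"

definition full_cycle :: "(nat \<Rightarrow> real) \<Rightarrow> nat set \<Rightarrow> nat \<Rightarrow> bool" where
  "full_cycle x S j \<longleftrightarrow> card S > 3 \<and> j \<in> {2..card S - 2} \<and>
    depth x S (j - 1) \<ge> depth x S j \<and> depth x S (j + 1) \<ge> depth x S j"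

text \<open>
  \<open>rainflow x S\<close> runs the loop from \<open>S\<^sub>r = S\<close>. It returns the extracted pairs \<open>S\<^sub>f\<close>, in the order of
  extraction, and the final \<open>S\<^sub>r\<close>. No pair can be extracted twice, so a list represents \<open>S\<^sub>f\<close>
  without loss.
\<close>

function rainflow :: "(nat \<Rightarrow> real) \<Rightarrow> nat set \<Rightarrow> (nat \<times> nat) list \<times> nat set" where
  "rainflow x S =
    (if \<exists>j. full_cycle x S j
     then let j = LEAST j. full_cycle x S j;
              (F, R) = rainflow x (S - {elt S j, elt S (j + 1)})
          in (dir x S j # F, R)
     else ([], S))"
  by pat_completeness auto
termination
proof (relation "Wellfounded.measure (\<lambda>(x, S). card S)")
  fix x :: "nat \<Rightarrow> real" and S :: "nat set" and j
  assume "\<exists>j. full_cycle x S j" and j: "j = (LEAST j. full_cycle x S j)"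
  then have "full_cycle x S j"
    unfolding j by (auto intro: LeastI_ex)
  then have fin: "finite S" and lt: "j - 1 < card S"
    by (auto simp: full_cycle_def intro: card_ge_0_finite)
  have "elt S j \<in> S"
    unfolding elt_def by (rule finite_enumerate_in_set[OF fin lt])
  then have "card (S - {elt S j, elt S (j + 1)}) < card S"
    by (intro psubset_card_mono fin) auto
  then show "((x, S - {elt S j, elt S (j + 1)}), (x, S)) \<in> Wellfounded.measure (\<lambda>(x, S). card S)"
    by simp
qed simp

declare rainflow.simps [simp del]

definition edges :: "nat \<Rightarrow> (nat \<Rightarrow> real) \<Rightarrow> (nat \<times> nat) list" where
  "edges T x =
    (let (F, R) = rainflow x (turning_points T x)
     in concat (map (\<lambda>e. [e, e]) F) @ map (dir x R) [1..<card R])"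

text \<open>
  Column \<open>c\<close> belongs to the edge number \<open>card {s. s < c}\<close> (counted from \<open>0\<close>). There are at most
  \<open>T\<close> edges: the number of edges listed by \<^const>\<open>edges\<close> is \<open>card (turning_points T x) - 1\<close>.
\<close>

definition incidence ::
  "real ^ (('n::{finite,linorder}) option) \<Rightarrow> real ^ ('n::{finite,linorder}) ^ ('n option)" where
  "incidence x =
    (let es = edges CARD('n) (traj x)
     in \<chi> v c. let k = card {s. s < c} in
          if k < length es
          then (if v = node (fst (es ! k)) then 1 else if v = node (snd (es ! k)) then - 1 else 0)
          else 0)"

definition cycling_cost ::
  "real \<Rightarrow> real \<Rightarrow> real \<Rightarrow> real ^ (('n::{finite,linorder}) option) \<Rightarrow> real" where
  "cycling_cost \<alpha>\<^sub>b B E x =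
    \<alpha>\<^sub>b * B * E / 2 * (x \<bullet> (incidence x *v (transpose (incidence x) *v x)))"

definition storage_set ::
  "real \<Rightarrow> real \<Rightarrow> real \<Rightarrow> real \<Rightarrow> ((real ^ ('n::{finite,linorder})) \<times> (real ^ ('n option))) set" where
  "storage_set E u_lo u_hi x\<^sub>o = {(u, x).
    (\<forall>t\<in>{0..CARD('n)}. 0 \<le> traj x t \<and> traj x t \<le> 1) \<and>
    (\<forall>t\<in>{1..CARD('n)}. u_lo \<le> u $ step t \<and> u $ step t \<le> u_hi \<and>
       traj x t = traj x (t - 1) + u $ step t / E) \<and>
    traj x 0 = x\<^sub>o \<and> traj x CARD('n) = x\<^sub>o}"

definition gen_set :: "real \<Rightarrow> real \<Rightarrow> (real ^ 'n::finite) set" where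
  "gen_set g_lo g_hi = {g. \<forall>t. g_lo \<le> g $ t \<and> g $ t \<le> g_hi}"

definition gen_cost :: "real \<Rightarrow> real \<Rightarrow> real ^ 'n::finite \<Rightarrow> real" where
  "gen_cost \<alpha>\<^sub>g \<beta>\<^sub>g g = \<alpha>\<^sub>g * (g \<bullet> g) + \<beta>\<^sub>g * (1 \<bullet> g)"

text \<open>
  The minimum is rendered as an infimum; the objective is bounded below on the constraint set
  when \<open>\<alpha>\<^sub>b\<close>, \<open>B\<close> and \<open>E\<close> are nonnegative.
\<close>

definition dual_function ::
  "real \<Rightarrow> real \<Rightarrow> real \<Rightarrow> real \<Rightarrow> real ^ ('n::finite) \<Rightarrow> (real ^ ('n option) \<Rightarrow> real) \<Rightarrow>
   ((real ^ ('n::finite)) \<times> (real ^ ('n option))) set \<Rightarrow> real ^ ('n::finite) \<Rightarrow> real" where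
  "dual_function \<alpha>\<^sub>g \<beta>\<^sub>g g_lo g_hi D C S l =
    (INF (g, u, x)\<in>gen_set g_lo g_hi \<times> S.
       gen_cost \<alpha>\<^sub>g \<beta>\<^sub>g g + C x + l \<bullet> (D + u - g))"

end

(*
  Along a sequence whose increments strictly alternate in sign, extracting a full cycle of depth |b|
  between increments a and c with |a|, |c| >= |b| changes the sum of squared half-cycle depths by
  (a + b + c)^2 + 2 b^2 - a^2 - b^2 - c^2 = 2 (a + b) (b + c) >= 0. Hence C_s(x) >= k Q(x) for all x,
  where Q(x) is the sum of the (x_t - x_{t-1})^2 and k = alpha_b B E / 2. Full rank of M(x_opt) forces
  every time to be a turning point of x_opt and excludes full cycles. This is an open condition, under
  which C_s = k Q. So the first-order conditions of the dispatch problem at the optimum are those of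
  a convex problem, and with m the marginal generation cost at g_opt they yield
  C_s(x) + m u >= C_s(x_opt) + m u_opt + k Q(x - x_opt) on the storage set. Consequently there is no duality
  gap although C_s need not be convex, the optimal dual variable is m, and as x_0 is fixed the last
  term makes the solution of the storage subproblem unique.
*)
theory Submission
  imports Defs
begin

section \<open>Cycle extraction\<close>

text \<open>This function and \<open>alternating\<close> run over lists, so that an extraction is
  the passage from \<open>A @ [p, q, r, s] @ B\<close> to \<open>A @ [p, s] @ B\<close> and can be
  followed by induction on \<open>A\<close>.\<close>

fun path_energy :: "('a \<Rightarrow> real) \<Rightarrow> 'a list \<Rightarrow> real" where
  "path_energy x (a # b # L) = (x b - x a)\<^sup>2 + path_energy x (b # L)"
| "path_energy x L = 0"

fun alternating :: "('a \<Rightarrow> real) \<Rightarrow> 'a list \<Rightarrow> bool" where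
  "alternating x (a # b # c # L) \<longleftrightarrow> (x b - x a) * (x c - x b) < 0 \<and> alternating x (b # c # L)"
| "alternating x L \<longleftrightarrow> True"

lemma path_energy_conv_sum:
  "path_energy x L = (\<Sum>i<length L - 1. (x (L ! Suc i) - x (L ! i))\<^sup>2)"
  by (induction x L rule: path_energy.induct) (simp_all add: sum.lessThan_Suc_shift del: sum.lessThan_Suc)

text \<open>As \<open>b\<close> is smallest in modulus and opposite in sign to \<open>a\<close> and
  \<open>c\<close>, both \<open>a + b\<close> and \<open>b + c\<close> have weakly the common sign
  of \<open>a\<close> and \<open>c\<close>, so their product is nonnegative.\<close>

lemma triple_merge_energy:
  fixes a b c :: real
  assumes "a * b < 0" "b * c < 0" "\<bar>b\<bar> \<le> \<bar>a\<bar>" "\<bar>b\<bar> \<le> \<bar>c\<bar>"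
  shows "a\<^sup>2 + b\<^sup>2 + c\<^sup>2 \<le> (a + b + c)\<^sup>2 + 2 * b\<^sup>2"
proof -
  have "(a + b) * (b + c) \<ge> 0"
    using assms by (auto simp: mult_less_0_iff intro: mult_nonneg_nonneg mult_nonpos_nonpos)
  then show ?thesis
    by (simp add: power2_eq_square algebra_simps)
qed

text \<open>The merged increment is \<open>a + b\<close>, weakly of the sign of \<open>a\<close>,
  plus \<open>c\<close>, strictly of that same sign.\<close>

lemma triple_merge_sign:
  fixes a b c d :: real
  assumes "a * b < 0" "b * c < 0" "\<bar>b\<bar> \<le> \<bar>a\<bar>" "\<bar>b\<bar> \<le> \<bar>c\<bar>"
  shows "d * a < 0 \<Longrightarrow> d * (a + b + c) < 0" and "c * d < 0 \<Longrightarrow> (a + b + c) * d < 0"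
  using assms by (auto simp: mult_less_0_iff)

text \<open>Only the three increments among \<open>p\<close>, \<open>q\<close>, \<open>r\<close>,
  \<open>s\<close> differ, so \<open>triple_merge_energy\<close> decides. The induction on
  \<open>A\<close> peels with two entries in view because \<open>alternating\<close> inspects three
  at a time.\<close>

lemma path_energy_extract:
  assumes "alternating x (A @ [p, q, r, s] @ B)"
    and "\<bar>x r - x q\<bar> \<le> \<bar>x q - x p\<bar>" "\<bar>x r - x q\<bar> \<le> \<bar>x s - x r\<bar>"
  shows "path_energy x (A @ [p, q, r, s] @ B) \<le> path_energy x (A @ [p, s] @ B) + 2 * (x r - x q)\<^sup>2"
  using assms
proof (induction A rule: induct_list012)
  case 1
  then show ?case
    using triple_merge_energy[of "x q - x p" "x r - x q" "x s - x r"] by (cases B) auto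
next
  case (2 z)
  then show ?case
    using triple_merge_energy[of "x q - x p" "x r - x q" "x s - x r"] by (cases B) auto
next
  case (3 y z A)
  then show ?case by (cases A) auto
qed

text \<open>The sign conditions can change only at \<open>p\<close> and at \<open>s\<close>. Both
  compare an outer increment with the merged one, as in \<open>triple_merge_sign\<close>.\<close>

lemma alternating_extract:
  assumes "alternating x (A @ [p, q, r, s] @ B)"
    and "\<bar>x r - x q\<bar> \<le> \<bar>x q - x p\<bar>" "\<bar>x r - x q\<bar> \<le> \<bar>x s - x r\<bar>"
  shows "alternating x (A @ [p, s] @ B)"
  using assms
proof (induction A rule: induct_list012)
  case 1
  then show ?case
    using triple_merge_sign(2)[of "x q - x p" "x r - x q" "x s - x r"] by (cases B) auto
next
  case (2 z)
  then show ?case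
    using triple_merge_sign[of "x q - x p" "x r - x q" "x s - x r"] by (cases B) auto
next
  case (3 y z A)
  then show ?case by (cases A) auto
qed

section \<open>Positions in a finite set of times\<close>

lemma sorted_list_of_set_conv_enumerate:
  fixes S :: "nat set"
  assumes "finite S"
  shows "sorted_list_of_set S = map (enumerate S) [0..<card S]"
proof (rule strict_sorted_equal)
  show "sorted_wrt (<) (map (enumerate S) [0..<card S])"
    unfolding sorted_wrt_map
    using assms by (auto simp: sorted_wrt_iff_nth_less finite_enumerate_mono)
  have "enumerate S ` {0..<card S} = S"
    using finite_bij_enumerate[OF assms] by (auto simp: bij_betw_def lessThan_atLeast0)
  then show "set (sorted_list_of_set S) = set (map (enumerate S) [0..<card S])"
    using assms by simp
qed simp

lemma elt_conv_nth:
  assumes "finite S" "j - 1 < card S"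
  shows "elt S j = sorted_list_of_set S ! (j - 1)"
  using assms by (simp add: sorted_list_of_set_conv_enumerate elt_def)

lemma elt_in:
  assumes "finite S" "j - 1 < card S"
  shows "elt S j \<in> S"
  unfolding elt_def using assms by (rule finite_enumerate_in_set)

lemma elt_less:
  assumes "finite S" "i < j" "1 \<le> i" "j - 1 < card S"
  shows "elt S i < elt S j"
  unfolding elt_def using assms by (intro finite_enumerate_mono) auto

text \<open>Turns a cycle found by position into the list pattern of the extraction lemmas. The
  range of \<open>j\<close> guarantees a neighbour on either side of the pair.\<close>

lemma full_cycle_split:
  assumes "finite S" "full_cycle x S j"
  obtains A B where
    "sorted_list_of_set S = A @ [elt S (j - 1), elt S j, elt S (j + 1), elt S (j + 2)] @ B"
    "sorted_list_of_set (S - {elt S j, elt S (j + 1)}) = A @ [elt S (j - 1), elt S (j + 2)] @ B"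
proof -
  let ?L = "sorted_list_of_set S" and ?p = "elt S (j - 1)" and ?q = "elt S j"
    and ?r = "elt S (j + 1)" and ?s = "elt S (j + 2)"
  define A B where "A = take (j - 2) ?L" and "B = drop (j + 2) ?L"
  from assms(2) have j: "2 \<le> j" "j + 2 \<le> card S"
    by (auto simp: full_cycle_def)
  \<comment> \<open>With \<open>j = i + 2\<close> the truncated subtractions become
    successors.\<close>
  obtain i where i: "j = i + 2"
    using j by (metis add.commute le_Suc_ex)
  have len: "length ?L = card S"
    by simp
  have nth: "?p = ?L ! i" "?q = ?L ! Suc i" "?r = ?L ! Suc (Suc i)" "?s = ?L ! Suc (Suc (Suc i))"
    using assms(1) j by (simp_all add: elt_conv_nth i)
  have L: "?L = A @ [?p, ?q, ?r, ?s] @ B"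
    unfolding A_def B_def nth using j len
    by (simp add: i Cons_nth_drop_Suc)
  have "distinct ?L" "sorted_wrt (<) ?L"
    by simp_all
  then have dist: "distinct (A @ [?p, ?q, ?r, ?s] @ B)" and sorted: "sorted_wrt (<) (A @ [?p, ?q, ?r, ?s] @ B)"
    unfolding L[symmetric] by simp_all
  have "sorted_list_of_set (S - {?q, ?r}) = A @ [?p, ?s] @ B"
  proof (rule strict_sorted_equal)
    show "sorted_wrt (<) (A @ [?p, ?s] @ B)"
      using sorted by (auto simp: sorted_wrt_append)
    have "S = set (A @ [?p, ?q, ?r, ?s] @ B)"
      using L assms(1) by (metis set_sorted_list_of_set)
    then show "set (sorted_list_of_set (S - {?q, ?r})) = set (A @ [?p, ?s] @ B)"
      using dist assms(1) by auto
  qed simp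
  with L that show ?thesis by blast
qed

section \<open>Squared half-cycle depths under the rainflow loop\<close>

definition edge_energy :: "('a \<Rightarrow> real) \<Rightarrow> 'a \<times> 'a \<Rightarrow> real" where
  "edge_energy x e = (x (fst e) - x (snd e))\<^sup>2"

text \<open>One round of the loop. The minimality of \<open>j\<close> is dropped, since the later
  arguments work for any admissible choice.\<close>

lemma rainflow_cases:
  obtains (cycle) j F R where "full_cycle x S j" "rainflow x S = (dir x S j # F, R)"
      "rainflow x (S - {elt S j, elt S (j + 1)}) = (F, R)"
    | (stop) "\<And>j. \<not> full_cycle x S j" "rainflow x S = ([], S)"
proof (cases "\<exists>j. full_cycle x S j")
  case True
  define j where "j = (LEAST j. full_cycle x S j)"
  obtain F R where FR: "rainflow x (S - {elt S j, elt S (j + 1)}) = (F, R)"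
    by fastforce
  have "full_cycle x S j"
    unfolding j_def using True by (rule LeastI_ex)
  moreover have "rainflow x S = (dir x S j # F, R)"
    using True FR by (subst rainflow.simps) (simp add: j_def Let_def)
  ultimately show thesis
    using FR cycle by blast
next
  case False
  then show thesis
    by (intro stop) (auto simp: rainflow.simps[of x S])
qed

lemma card_extract:
  assumes "finite S" "full_cycle x S j"
  shows "card (S - {elt S j, elt S (j + 1)}) + 2 = card S" and "elt S j \<in> S" "elt S (j + 1) \<in> S"
    and "elt S j \<noteq> elt S (j + 1)"
proof -
  have j: "2 \<le> j" "j + 2 \<le> card S"
    using assms(2) by (auto simp: full_cycle_def)
  show in_S: "elt S j \<in> S" "elt S (j + 1) \<in> S"
    using assms(1) j by (auto intro!: elt_in)
  show neq: "elt S j \<noteq> elt S (j + 1)"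
    using elt_less[OF assms(1), of j "j + 1"] j by auto
  show "card (S - {elt S j, elt S (j + 1)}) + 2 = card S"
    using in_S neq j assms(1) by (subst card_Diff_subset) auto
qed

text \<open>Each round removes two points and lists one pair, which later counts as two edges. This
  balance gives the total number of edges.\<close>

lemma rainflow_structure:
  assumes "finite S" "rainflow x S = (F, R)"
  shows "R \<subseteq> S" and "2 * length F + card R = card S" and "S \<noteq> {} \<Longrightarrow> card R \<ge> 1"
    and "\<And>e. e \<in> set F \<Longrightarrow> fst e \<in> S \<and> snd e \<in> S \<and> fst e \<noteq> snd e"
proof -
  have "R \<subseteq> S \<and> 2 * length F + card R = card S \<and> (S \<noteq> {} \<longrightarrow> card R \<ge> 1) \<and>
      (\<forall>e\<in>set F. fst e \<in> S \<and> snd e \<in> S \<and> fst e \<noteq> snd e)"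
    using assms
  proof (induction "card S" arbitrary: S F R rule: less_induct)
    case less
    show ?case
    proof (cases x S rule: rainflow_cases)
      case (cycle j F' R')
      let ?S = "S - {elt S j, elt S (j + 1)}"
      note ex = card_extract[OF less.prems(1) cycle(1)]
      have "card S > 3"
        using cycle(1) by (simp add: full_cycle_def)
      then have "card ?S \<noteq> 0"
        using ex(1) by linarith
      then have "?S \<noteq> {}"
        by (metis card.empty)
      moreover have "F = dir x S j # F'" "R = R'"
        using cycle(2) less.prems(2) by simp_all
      moreover have "R' \<subseteq> ?S \<and> 2 * length F' + card R' = card ?S \<and> (?S \<noteq> {} \<longrightarrow> card R' \<ge> 1) \<and>
          (\<forall>e\<in>set F'. fst e \<in> ?S \<and> snd e \<in> ?S \<and> fst e \<noteq> snd e)"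
        using ex(1) less.prems(1) cycle(3) by (intro less.hyps) auto
      ultimately show ?thesis
        using ex by (auto simp: dir_def)
    next
      case stop
      then show ?thesis
        using less.prems by (auto simp: Suc_le_eq card_gt_0_iff)
    qed
  qed
  then show "R \<subseteq> S" and "2 * length F + card R = card S" and "S \<noteq> {} \<Longrightarrow> card R \<ge> 1"
    and "\<And>e. e \<in> set F \<Longrightarrow> fst e \<in> S \<and> snd e \<in> S \<and> fst e \<noteq> snd e"
    by blast+
qed

lemma edge_energy_dir: "edge_energy x (dir x S j) = (x (elt S (j + 1)) - x (elt S j))\<^sup>2"
  by (auto simp: edge_energy_def dir_def power2_commute)

text \<open>By \<open>path_energy_extract\<close>, a round lowers the path energy by at most twice
  the squared depth of the extracted pair. Alternation is carried through the induction because the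
  next round needs it.\<close>

lemma rainflow_energy:
  assumes "finite S" "alternating x (sorted_list_of_set S)" "rainflow x S = (F, R)"
  shows "path_energy x (sorted_list_of_set S)
    \<le> 2 * sum_list (map (edge_energy x) F) + path_energy x (sorted_list_of_set R)"
  using assms
proof (induction "card S" arbitrary: S F R rule: less_induct)
  case less
  show ?case
  proof (cases x S rule: rainflow_cases)
    case (cycle j F' R')
    let ?S = "S - {elt S j, elt S (j + 1)}"
    have F: "F = dir x S j # F'" "R = R'"
      using cycle(2) less.prems(3) by simp_all
    have j: "2 \<le> j" and d: "depth x S j \<le> depth x S (j - 1)" "depth x S j \<le> depth x S (j + 1)"
      using cycle(1) by (auto simp: full_cycle_def)
    have d1: "\<bar>x (elt S (j + 1)) - x (elt S j)\<bar> \<le> \<bar>x (elt S j) - x (elt S (j - 1))\<bar>"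
      and d2: "\<bar>x (elt S (j + 1)) - x (elt S j)\<bar> \<le> \<bar>x (elt S (j + 2)) - x (elt S (j + 1))\<bar>"
      using d j by (simp_all add: depth_def)
    obtain A B where L:
      "sorted_list_of_set S = A @ [elt S (j - 1), elt S j, elt S (j + 1), elt S (j + 2)] @ B"
      "sorted_list_of_set ?S = A @ [elt S (j - 1), elt S (j + 2)] @ B"
      using full_cycle_split[OF less.prems(1) cycle(1)] .
    note alt = less.prems(2)[unfolded L(1)]
    have "alternating x (sorted_list_of_set ?S)"
      unfolding L(2) using alternating_extract[OF alt d1 d2] .
    then have "path_energy x (sorted_list_of_set ?S)
        \<le> 2 * sum_list (map (edge_energy x) F') + path_energy x (sorted_list_of_set R')"
      using card_extract(1)[OF less.prems(1) cycle(1)] less.prems(1) cycle(3) by (intro less.hyps) auto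
    then show ?thesis
      using path_energy_extract[OF alt d1 d2] unfolding L F by (simp add: edge_energy_dir)
  next
    case stop
    then show ?thesis
      using less.prems(3) by simp
  qed
qed

lemma edge_energy_path:
  assumes "finite R"
  shows "sum_list (map (edge_energy x) (map (dir x R) [1..<card R])) = path_energy x (sorted_list_of_set R)"
proof -
  have "sum_list (map (edge_energy x) (map (dir x R) [1..<card R]))
      = (\<Sum>i\<in>{1..<card R}. edge_energy x (dir x R i))"
    by (simp add: o_def interv_sum_list_conv_sum_set_nat)
  also have "\<dots> = (\<Sum>i<card R - 1. edge_energy x (dir x R (Suc i)))"
    by (rule sum.reindex_bij_witness[of _ Suc "\<lambda>i. i - 1"]) auto
  also have "\<dots> = path_energy x (sorted_list_of_set R)"
    unfolding path_energy_conv_sum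
    by (rule sum.cong) (auto simp: edge_energy_dir elt_conv_nth assms)
  finally show ?thesis .
qed

section \<open>The list of all edges\<close>

lemma sum_list_concat_pairs:
  fixes f :: "'a \<Rightarrow> real"
  shows "sum_list (map f (concat (map (\<lambda>e. [e, e]) F))) = 2 * sum_list (map f F)"
  by (induction F) auto

lemma length_concat_pairs: "length (concat (map (\<lambda>e. [e, e]) F)) = 2 * length F"
  by (induction F) auto

lemma turning_points_subset: "turning_points T x \<subseteq> {0..T}"
  by (auto simp: turning_points_def)

lemma finite_turning_points [simp]: "finite (turning_points T x)"
  using turning_points_subset finite_subset by blast

lemma length_edges: "length (edges T x) = card (turning_points T x) - 1"
proof -
  obtain F R where FR: "rainflow x (turning_points T x) = (F, R)"
    by fastforce
  moreover have "turning_points T x \<noteq> {}"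
    by (auto simp: turning_points_def)
  ultimately show ?thesis
    using rainflow_structure(2,3)[OF finite_turning_points FR]
    by (simp add: edges_def length_concat_pairs)
qed

text \<open>So no edge is lost when the list is placed in the \<open>T\<close> columns of the
  incidence matrix.\<close>

lemma length_edges_le: "length (edges T x) \<le> T"
  using card_mono[OF _ turning_points_subset, of T x] by (simp add: length_edges)

text \<open>Distinct end points put the entries \<open>1\<close> and \<open>- 1\<close> of a column
  in different rows; the bound \<open>T\<close> is what makes \<open>node\<close> injective on
  them.\<close>

lemma edges_valid:
  assumes "e \<in> set (edges T x)"
  shows "fst e \<le> T" "snd e \<le> T" "fst e \<noteq> snd e"
proof -
  let ?S = "turning_points T x"
  obtain F R where FR: "rainflow x ?S = (F, R)"
    by fastforce
  note st = rainflow_structure[OF finite_turning_points FR]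
  have R: "finite R" "R \<subseteq> {0..T}"
    using st(1) turning_points_subset[of T x] by (auto intro: finite_subset)
  from assms have "e \<in> set F \<or> (\<exists>j. 1 \<le> j \<and> j < card R \<and> e = dir x R j)"
    by (auto simp: edges_def FR)
  then have "fst e \<in> {0..T} \<and> snd e \<in> {0..T} \<and> fst e \<noteq> snd e"
  proof
    assume "e \<in> set F"
    then show ?thesis
      using st(4) turning_points_subset by blast
  next
    assume "\<exists>j. 1 \<le> j \<and> j < card R \<and> e = dir x R j"
    then obtain j where j: "1 \<le> j" "j < card R" "e = dir x R j" by blast
    have "elt R j \<in> R" "elt R (j + 1) \<in> R" "elt R j < elt R (j + 1)"
      using j R(1) by (auto intro!: elt_in elt_less)
    then show ?thesis
      using j(3) R(2) by (auto simp: dir_def)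
  qed
  then show "fst e \<le> T" "snd e \<le> T" "fst e \<noteq> snd e"
    by auto
qed

section \<open>Turning points\<close>

text \<open>Here \<open>t'\<close> is \<open>s + 1\<close> for the \<open>s\<close> of the
  definition, the time at which the first nonzero increment after \<open>t\<close> ends. Opposite
  signs become a negative product.\<close>

lemma turning_pointI:
  fixes x :: "nat \<Rightarrow> real"
  assumes "0 < t" "t < t'" "t' \<le> T" "\<And>r. t < r \<Longrightarrow> r < t' \<Longrightarrow> x r = x (r - 1)"
    and neg: "(x t - x (t - 1)) * (x t' - x (t' - 1)) < 0"
  shows "t \<in> turning_points T x"
proof -
  have "x (t' - 1 + 1) = x t'"
    using assms by simp
  then have s: "x (t' - 1 + 1) \<noteq> x (t' - 1)"
      "sgn (x (t' - 1 + 1) - x (t' - 1)) = - sgn (x t - x (t - 1))"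
    using neg by (auto simp: mult_less_0_iff)
  moreover have "x (r + 1) = x r" if "r \<in> {t..<t' - 1}" for r
    using assms(4)[of "r + 1"] that by auto
  ultimately have "\<exists>s\<in>{t..<T}. x (s + 1) \<noteq> x s \<and> (\<forall>r\<in>{t..<s}. x (r + 1) = x r) \<and>
         sgn (x (s + 1) - x s) = - sgn (x t - x (t - 1))"
    using assms(2,3) by (intro bexI[of _ "t' - 1"]) auto
  moreover have "x t \<noteq> x (t - 1)"
    using neg by auto
  ultimately show ?thesis
    using assms(1-3) unfolding turning_points_def by simp
qed

lemma turning_pointE:
  fixes x :: "nat \<Rightarrow> real"
  assumes "t \<in> turning_points T x" "0 < t" "t < T"
  obtains t' where "t < t'" "t' \<le> T" "\<And>r. t < r \<Longrightarrow> r < t' \<Longrightarrow> x r = x (r - 1)"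
    "(x t - x (t - 1)) * (x t' - x (t' - 1)) < 0"
proof -
  from assms obtain s where s: "t \<le> s" "s < T" "x (s + 1) \<noteq> x s" "\<forall>r\<in>{t..<s}. x (r + 1) = x r"
    "sgn (x (s + 1) - x s) = - sgn (x t - x (t - 1))" and t: "x t \<noteq> x (t - 1)"
    unfolding turning_points_def by auto
  show thesis
  proof (rule that[of "s + 1"])
    show "x r = x (r - 1)" if "t < r" "r < s + 1" for r
      using that s(4)[rule_format, of "r - 1"] by (cases r) auto
    have "sgn ((x t - x (t - 1)) * (x (s + 1) - x s)) = - (sgn (x t - x (t - 1)))\<^sup>2"
      using s(5) by (simp add: sgn_mult power2_eq_square)
    also have "\<dots> = - 1"
      using t by (auto simp: sgn_if)
    finally have "sgn ((x t - x (t - 1)) * (x (s + 1) - x s)) < 0"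
      by simp
    then show "(x t - x (t - 1)) * (x (s + 1) - x (s + 1 - 1)) < 0"
      by (simp only: sgn_less add_diff_cancel_right')
  qed (use s in auto)
qed

text \<open>Induction on \<open>b - a\<close>. A nonzero increment strictly in between is opposite
  in sign to one of the two outer ones, which leaves a shorter interval. If there is none,
  \<open>a\<close> itself is a turning point.\<close>

lemma turning_point_between:
  fixes x :: "nat \<Rightarrow> real"
  assumes "0 < a" "a < b" "b \<le> T" "(x a - x (a - 1)) * (x b - x (b - 1)) < 0"
  shows "\<exists>t\<in>{a..<b}. t \<in> turning_points T x"
  using assms
proof (induction "b - a" arbitrary: a b rule: less_induct)
  case less
  show ?case
  proof (cases "\<exists>r. a < r \<and> r < b \<and> x r \<noteq> x (r - 1)")
    case True
    then obtain r where r: "a < r" "r < b" "x r \<noteq> x (r - 1)" by blast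
    have "x r < x (r - 1) \<or> x (r - 1) < x r"
      using r(3) by linarith
    then consider "(x a - x (a - 1)) * (x r - x (r - 1)) < 0" | "(x r - x (r - 1)) * (x b - x (b - 1)) < 0"
      using less.prems(4) by (auto simp: mult_less_0_iff)
    then show ?thesis
    proof cases
      case 1
      then have "\<exists>t\<in>{a..<r}. t \<in> turning_points T x"
        using less.prems r by (intro less.hyps) auto
      then show ?thesis using r by auto
    next
      case 2
      then have "\<exists>t\<in>{r..<b}. t \<in> turning_points T x"
        using less.prems r by (intro less.hyps) auto
      then show ?thesis using r by auto
    qed
  next
    case False
    then have "a \<in> turning_points T x"
      using less.prems by (intro turning_pointI[of a b]) auto
    then show ?thesis using less.prems by auto
  qed
qed

section \<open>Weakly monotone stretches\<close>

definition same_direction :: "(nat \<Rightarrow> real) \<Rightarrow> nat \<Rightarrow> nat \<Rightarrow> bool" where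
  "same_direction x a b \<longleftrightarrow>
    (\<forall>s\<in>{a<..b}. \<forall>t\<in>{a<..b}. (x s - x (s - 1)) * (x t - x (t - 1)) \<ge> 0)"

text \<open>Two increments of opposite sign would force a turning point strictly between
  \<open>a\<close> and \<open>b\<close>. Expressing monotonicity by products treats rising and
  falling stretches alike.\<close>

lemma same_directionI:
  assumes "b \<le> T" "\<And>t. a < t \<Longrightarrow> t < b \<Longrightarrow> t \<notin> turning_points T x"
  shows "same_direction x a b"
proof -
  have *: "(x s - x (s - 1)) * (x t - x (t - 1)) \<ge> 0" if "a < s" "s < t" "t \<le> b" for s t
    using turning_point_between[of s t T x] assms that by force
  show ?thesis
    unfolding same_direction_def
  proof (intro ballI)
    fix s t assume "s \<in> {a<..b}" "t \<in> {a<..b}"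
    then show "(x s - x (s - 1)) * (x t - x (t - 1)) \<ge> 0"
      using *[of s t] *[of t s] by (cases s t rule: linorder_cases) (auto simp: mult.commute)
  qed
qed

lemma sum_increments:
  fixes x :: "nat \<Rightarrow> real"
  assumes "a \<le> b"
  shows "(\<Sum>t\<in>{a<..b}. x t - x (t - 1)) = x b - x a"
  using sum_telescope''[OF assms, of x] by (simp add: atLeastSucAtMost_greaterThanAtMost)

text \<open>By telescoping, the product is a sum of nonnegative terms, and the term for
  \<open>t\<close> is a positive square.\<close>

lemma same_direction_strict:
  assumes "same_direction x a b" "a < t" "t \<le> b" "x t \<noteq> x (t - 1)"
  shows "(x t - x (t - 1)) * (x b - x a) > 0"
proof -
  have "0 < (x t - x (t - 1)) * (x t - x (t - 1))"
    using assms(4) by (simp flip: power2_eq_square)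
  also have "\<dots> \<le> (\<Sum>s\<in>{a<..b}. (x t - x (t - 1)) * (x s - x (s - 1)))"
    using assms by (intro member_le_sum) (auto simp: same_direction_def)
  also have "\<dots> = (x t - x (t - 1)) * (x b - x a)"
    unfolding sum_distrib_left[symmetric] using assms by (subst sum_increments) simp_all
  finally show ?thesis .
qed

text \<open>The telescoped square expands into a double sum of nonnegative terms, of which the left
  side is the diagonal.\<close>

lemma same_direction_energy:
  assumes "same_direction x a b" "a \<le> b"
  shows "(\<Sum>t\<in>{a<..b}. (x t - x (t - 1))\<^sup>2) \<le> (x b - x a)\<^sup>2"
proof -
  have "(\<Sum>t\<in>{a<..b}. (x t - x (t - 1))\<^sup>2)
      \<le> (\<Sum>t\<in>{a<..b}. \<Sum>s\<in>{a<..b}. (x t - x (t - 1)) * (x s - x (s - 1)))"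
    unfolding power2_eq_square
  proof (rule sum_mono)
    fix t assume t: "t \<in> {a<..b}"
    show "(x t - x (t - 1)) * (x t - x (t - 1)) \<le> (\<Sum>s\<in>{a<..b}. (x t - x (t - 1)) * (x s - x (s - 1)))"
      using assms t by (intro member_le_sum) (auto simp: same_direction_def)
  qed
  also have "\<dots> = (x b - x a)\<^sup>2"
    unfolding sum_product[symmetric] sum_increments[OF assms(2)] power2_eq_square ..
  finally show ?thesis .
qed

definition sq_variation :: "nat \<Rightarrow> (nat \<Rightarrow> real) \<Rightarrow> real" where
  "sq_variation T x = (\<Sum>t\<in>{0<..T}. (x t - x (t - 1))\<^sup>2)"

lemma path_energy_ge_increments:
  assumes "L \<noteq> []" "sorted L" "\<And>i. Suc i < length L \<Longrightarrow> same_direction x (L ! i) (L ! Suc i)"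
  shows "(\<Sum>t\<in>{hd L<..last L}. (x t - x (t - 1))\<^sup>2) \<le> path_energy x L"
  using assms
proof (induction x L rule: path_energy.induct)
  case (1 x a b L)
  have ab: "a \<le> b" "b \<le> last (b # L)"
    using 1(3) by (auto split: if_splits)
  have "(\<Sum>t\<in>{a<..last (b # L)}. (x t - x (t - 1))\<^sup>2)
      = (\<Sum>t\<in>{a<..b}. (x t - x (t - 1))\<^sup>2) + (\<Sum>t\<in>{b<..last (b # L)}. (x t - x (t - 1))\<^sup>2)"
    using ab by (subst sum.union_disjoint[symmetric]) (auto intro!: sum.cong)
  also have "\<dots> \<le> (x b - x a)\<^sup>2 + path_energy x (b # L)"
  proof (rule add_mono)
    show "(\<Sum>t\<in>{a<..b}. (x t - x (t - 1))\<^sup>2) \<le> (x b - x a)\<^sup>2"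
      using 1(4)[of 0] ab by (intro same_direction_energy) auto
    have "same_direction x ((b # L) ! i) ((b # L) ! Suc i)" if "Suc i < length (b # L)" for i
      using 1(4)[of "Suc i"] that by auto
    then show "(\<Sum>t\<in>{b<..last (b # L)}. (x t - x (t - 1))\<^sup>2) \<le> path_energy x (b # L)"
      using 1(1)[OF _ _ ] 1(3) by simp
  qed
  finally show ?case by simp
qed auto

lemma alternatingI:
  assumes "\<And>i. Suc (Suc i) < length L \<Longrightarrow>
    (x (L ! Suc i) - x (L ! i)) * (x (L ! Suc (Suc i)) - x (L ! Suc i)) < 0"
  shows "alternating x L"
  using assms
proof (induction x L rule: alternating.induct)
  case (1 x a b c L)
  have "alternating x (b # c # L)"
    using 1(2)[of "Suc i" for i] by (intro 1(1)) auto
  then show ?case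
    using 1(2)[of 0] by simp
qed auto

lemma no_element_between_consecutive:
  fixes S :: "nat set"
  assumes "finite S" "Suc i < card S" "sorted_list_of_set S ! i < t" "t < sorted_list_of_set S ! Suc i"
  shows "t \<notin> S"
proof
  let ?L = "sorted_list_of_set S"
  assume "t \<in> S"
  then obtain k where k: "k < length ?L" "t = ?L ! k"
    using assms(1) by (metis in_set_conv_nth set_sorted_list_of_set)
  have "sorted ?L" by simp
  then have "i < k" "k < Suc i"
    using assms k sorted_nth_mono[of ?L k i] sorted_nth_mono[of ?L "Suc i" k]
    by (auto simp flip: not_le)
  then show False by simp
qed

text \<open>Stretches between consecutive turning points are monotone. At an interior turning point
  the increment before it and the next nonzero one have opposite signs, and each fixes the direction
  of its stretch.\<close>

lemma
  fixes x :: "nat \<Rightarrow> real" and T :: nat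
  defines "L \<equiv> sorted_list_of_set (turning_points T x)"
  shows alternating_turning_points: "alternating x L"
    and path_energy_turning_points: "sq_variation T x \<le> path_energy x L"
proof -
  let ?S = "turning_points T x"
  have len: "length L = card ?S" and set: "set L = ?S" and sorted: "sorted_wrt (<) L"
    unfolding L_def by simp_all
  have mem: "L ! i \<in> ?S" if "i < length L" for i
    using that set nth_mem by metis
  have le_T: "L ! i \<le> T" if "i < length L" for i
    using mem[OF that] turning_points_subset by fastforce
  have less: "L ! i < L ! j" if "i < j" "j < length L" for i j
    using that sorted by (simp add: sorted_wrt_iff_nth_less)
  have seg: "same_direction x (L ! i) (L ! Suc i)" if "Suc i < length L" for i
    using that len le_T no_element_between_consecutive[of ?S i] unfolding L_def[symmetric]
    by (intro same_directionI[of _ T]) auto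
  show "alternating x L"
  proof (rule alternatingI)
    fix i assume i: "Suc (Suc i) < length L"
    let ?a = "L ! i" and ?b = "L ! Suc i" and ?c = "L ! Suc (Suc i)"
    have abc: "?a < ?b" "?b < ?c" "?c \<le> T"
      using i less le_T by auto
    then obtain t where t: "?b < t" "t \<le> T" "\<And>r. ?b < r \<Longrightarrow> r < t \<Longrightarrow> x r = x (r - 1)"
      "(x ?b - x (?b - 1)) * (x t - x (t - 1)) < 0"
      using turning_pointE[of ?b T x] mem[of "Suc i"] i by auto
    \<comment> \<open>The next nonzero increment lies in the stretch up to \<open>?c\<close>:
      otherwise the increment at \<open>?c\<close> would vanish, although \<open>?c\<close> would be
      an interior turning point.\<close>
    have "t \<le> ?c"
    proof (rule ccontr)
      assume "\<not> t \<le> ?c"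
      then have "x ?c = x (?c - 1)" "?c < T"
        using t abc by auto
      moreover obtain t' where "(x ?c - x (?c - 1)) * (x t' - x (t' - 1)) < 0"
        using turning_pointE[OF mem[OF i] _ \<open>?c < T\<close>] abc by (metis gr0I not_less_zero)
      ultimately show False
        by simp
    qed
    then have "(x t - x (t - 1)) * (x ?c - x ?b) > 0"
      using t i by (intro same_direction_strict[OF seg[of "Suc i"]]) auto
    moreover have "(x ?b - x (?b - 1)) * (x ?b - x ?a) > 0"
      using t i abc by (intro same_direction_strict[OF seg[of i]]) auto
    ultimately show "(x ?b - x ?a) * (x ?c - x ?b) < 0"
      using t(4) by (auto simp: mult_less_0_iff zero_less_mult_iff)
  qed
  have ne: "L \<noteq> []" and mem0: "0 \<in> set L" "T \<in> set L"
    using set by (auto simp: turning_points_def)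
  have srt: "sorted L"
    unfolding L_def by simp
  have "hd L = 0"
    using mem0(1) srt ne by (cases L) auto
  moreover have "\<forall>z\<in>set L. z \<le> T"
    using set turning_points_subset[of T x] by auto
  then have "last L = T"
    using mem0(2) srt ne by (cases L rule: rev_cases) (auto simp: sorted_append)
  ultimately show "sq_variation T x \<le> path_energy x L"
    using path_energy_ge_increments[OF ne srt seg] by (simp add: sq_variation_def)
qed

text \<open>Two comparisons in the same direction: contracting monotone stretches to their end
  points does not lower the sum of squares, and neither does extracting cycles.\<close>

lemma sq_variation_le_edges: "sq_variation T x \<le> sum_list (map (edge_energy x) (edges T x))"
proof -
  let ?S = "turning_points T x"
  obtain F R where FR: "rainflow x ?S = (F, R)"
    by fastforce
  have "finite R"
    using rainflow_structure(1)[OF finite_turning_points FR] by (auto intro: finite_subset)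
  then have "sum_list (map (edge_energy x) (edges T x))
      = 2 * sum_list (map (edge_energy x) F) + path_energy x (sorted_list_of_set R)"
    using edge_energy_path[of R x] by (simp add: edges_def FR sum_list_concat_pairs)
  then show ?thesis
    using path_energy_turning_points[where T = T and x = x] rainflow_energy[OF finite_turning_points alternating_turning_points FR]
    by linarith
qed

section \<open>Trajectories with nothing to contract or extract\<close>

definition zigzag :: "nat \<Rightarrow> (nat \<Rightarrow> real) \<Rightarrow> bool" where
  "zigzag T x \<longleftrightarrow>
    (\<forall>t\<in>{1..<T}. (x t - x (t - 1)) * (x (t + 1) - x t) < 0) \<and>
    (\<forall>t\<in>{2..<T}. \<bar>x (t - 1) - x (t - 2)\<bar> < \<bar>x t - x (t - 1)\<bar> \<or> \<bar>x (t + 1) - x t\<bar> < \<bar>x t - x (t - 1)\<bar>)"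

lemma elt_atLeastAtMost:
  assumes "1 \<le> j" "j \<le> T + 1"
  shows "elt {0..T} j = j - 1"
proof -
  have "sorted_list_of_set {0..T} = [0..<Suc T]"
    by (metis atLeastLessThanSuc_atLeastAtMost sorted_list_of_set_range)
  then show ?thesis
    using assms by (simp add: elt_conv_nth del: upt_Suc)
qed

text \<open>Position \<open>j\<close> of \<open>{0..T}\<close> holds time \<open>j - 1\<close>, and
  there are \<open>T + 1\<close> positions. That there are more than three points follows from the
  range of \<open>j\<close>.\<close>

lemma full_cycle_atLeastAtMost:
  "full_cycle x {0..T} j \<longleftrightarrow> j \<in> {2..<T} \<and>
    \<bar>x j - x (j - 1)\<bar> \<le> \<bar>x (j - 1) - x (j - 2)\<bar> \<and> \<bar>x j - x (j - 1)\<bar> \<le> \<bar>x (j + 1) - x j\<bar>"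
proof (cases "j \<in> {2..<T}")
  case True
  then obtain i where i: "j = i + 2"
    by (metis add.commute atLeastLessThan_iff le_Suc_ex)
  have d: "depth x {0..T} (Suc t) = \<bar>x (Suc t) - x t\<bar>" if "Suc t \<le> T" for t
    using that by (simp add: depth_def elt_atLeastAtMost)
  have "full_cycle x {0..T} j \<longleftrightarrow> \<bar>x (Suc (Suc i)) - x (Suc i)\<bar> \<le> \<bar>x (Suc i) - x i\<bar> \<and>
      \<bar>x (Suc (Suc i)) - x (Suc i)\<bar> \<le> \<bar>x (Suc (Suc (Suc i))) - x (Suc (Suc i))\<bar>"
  proof -
    have "Suc (Suc i) \<le> T - Suc 0"
      using True i by auto
    then show ?thesis
      unfolding full_cycle_def using True by (simp add: i d)
  qed
  then show ?thesis
    using True by (simp add: i)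
next
  case False
  then show ?thesis
    by (auto simp: full_cycle_def)
qed

text \<open>Links the combinatorial condition on the rainflow run to strict inequalities between
  increments, which survive small perturbations.\<close>

lemma zigzag_iff:
  "zigzag T x \<longleftrightarrow> turning_points T x = {0..T} \<and> (\<forall>j. \<not> full_cycle x {0..T} j)"
proof -
  have "(\<forall>t\<in>{1..<T}. (x t - x (t - 1)) * (x (t + 1) - x t) < 0) \<longleftrightarrow> turning_points T x = {0..T}"
  proof
    assume *: "\<forall>t\<in>{1..<T}. (x t - x (t - 1)) * (x (t + 1) - x t) < 0"
    have "t \<in> turning_points T x" if "t \<in> {0..T}" for t
    proof (cases "t = 0 \<or> t = T")
      case False
      then show ?thesis
        using * that by (intro turning_pointI[of t "t + 1"]) auto
    qed (auto simp: turning_points_def)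
    then show "turning_points T x = {0..T}"
      using turning_points_subset by blast
  next
    assume *: "turning_points T x = {0..T}"
    show "\<forall>t\<in>{1..<T}. (x t - x (t - 1)) * (x (t + 1) - x t) < 0"
    proof
      fix t assume t: "t \<in> {1..<T}"
      then obtain t' where t': "t < t'" "t' \<le> T" "\<And>r. t < r \<Longrightarrow> r < t' \<Longrightarrow> x r = x (r - 1)"
        "(x t - x (t - 1)) * (x t' - x (t' - 1)) < 0"
        using turning_pointE[of t T x] * by auto
      \<comment> \<open>Were \<open>t'\<close> later, time \<open>t + 1\<close> would be an interior
        turning point with zero increment.\<close>
      have "t' = t + 1"
      proof (rule ccontr)
        assume "t' \<noteq> t + 1"
        then have "t + 1 < t'" using t'(1) by simp
        then show False
          using t'(3)[of "t + 1"] t'(2) turning_pointE[of "t + 1" T x] * by auto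
      qed
      then show "(x t - x (t - 1)) * (x (t + 1) - x t) < 0"
        using t'(4) by simp
    qed
  qed
  moreover have "(\<forall>t\<in>{2..<T}. \<bar>x (t - 1) - x (t - 2)\<bar> < \<bar>x t - x (t - 1)\<bar> \<or> \<bar>x (t + 1) - x t\<bar> < \<bar>x t - x (t - 1)\<bar>)
      \<longleftrightarrow> (\<forall>j. \<not> full_cycle x {0..T} j)"
    by (auto simp: full_cycle_atLeastAtMost not_le)
  ultimately show ?thesis
    by (simp add: zigzag_def)
qed

text \<open>The equality case of \<open>sq_variation_le_edges\<close>: the edges join consecutive
  times.\<close>

lemma sq_variation_eq_edges:
  assumes "zigzag T x"
  shows "sum_list (map (edge_energy x) (edges T x)) = sq_variation T x"
proof -
  have tp: "turning_points T x = {0..T}" and fc: "\<not> (\<exists>j. full_cycle x {0..T} j)"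
    using assms by (auto simp: zigzag_iff)
  have "rainflow x {0..T} = ([], {0..T})"
    using fc by (cases x "{0..T}" rule: rainflow_cases) auto
  then have "sum_list (map (edge_energy x) (edges T x)) = path_energy x (sorted_list_of_set {0..T})"
    using edge_energy_path[of "{0..T}" x] by (simp add: edges_def tp del: upt_Suc)
  also have "sorted_list_of_set {0..T} = [0..<Suc T]"
    by (metis atLeastLessThanSuc_atLeastAtMost sorted_list_of_set_range)
  also have "path_energy x [0..<Suc T] = (\<Sum>i<T. (x (Suc i) - x i)\<^sup>2)"
    by (auto simp: path_energy_conv_sum simp del: upt_Suc intro!: sum.cong)
  also have "\<dots> = sq_variation T x"
    unfolding sq_variation_def
    by (rule sum.reindex_bij_witness[of _ "\<lambda>t. t - 1" Suc]) auto
  finally show ?thesis .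
qed

text \<open>The count \<open>T\<close> makes all \<open>T + 1\<close> times turning points, and an
  extracted cycle would be listed twice.\<close>

lemma zigzag_if_distinct_edges:
  assumes "distinct (edges T x)" "length (edges T x) = T"
  shows "zigzag T x"
proof -
  let ?S = "turning_points T x"
  have "card ?S \<noteq> 0"
    by (auto simp: turning_points_def)
  then have "card ?S = card {0..T}"
    using assms(2) unfolding length_edges by (metis Suc_pred card_atLeastAtMost diff_zero neq0_conv One_nat_def)
  then have tp: "?S = {0..T}"
    using turning_points_subset by (intro card_subset_eq) auto
  moreover have "\<not> full_cycle x ?S j" for j
  proof (cases x ?S rule: rainflow_cases)
    case (cycle j F R)
    then show ?thesis
      using assms(1) by (simp add: edges_def)
  qed
  ultimately show ?thesis
    by (auto simp: zigzag_iff)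
qed

section \<open>The incidence matrix\<close>

lemma step_eq_iff:
  assumes "t \<in> {1..CARD('n::{finite,linorder})}" "t' \<in> {1..CARD('n)}"
  shows "(step t :: 'n) = step t' \<longleftrightarrow> t = t'"
  using assms unfolding step_def by (subst nth_eq_iff_index_eq) auto

lemma step_surj:
  obtains t where "t \<in> {1..CARD('n)}" "step t = (i :: 'n::{finite,linorder})"
proof -
  have "i \<in> set (sorted_list_of_set UNIV)"
    by simp
  then obtain k where "k < CARD('n)" "sorted_list_of_set UNIV ! k = i"
    unfolding in_set_conv_nth by auto
  then show thesis
    by (intro that[of "Suc k"]) (auto simp: step_def)
qed

lemma node_eq_iff:
  assumes "t \<le> CARD('n::{finite,linorder})" "t' \<le> CARD('n)"
  shows "(node t :: 'n option) = node t' \<longleftrightarrow> t = t'"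
  using assms step_eq_iff[of t t', where 'n = 'n] by (auto simp: node_def)

lemma node_surj:
  obtains t where "t \<le> CARD('n)" "node t = (v :: ('n::{finite,linorder}) option)"
proof (cases v)
  case None
  then show thesis
    by (intro that[of 0]) (auto simp: node_def)
next
  case (Some i)
  then obtain t where "t \<in> {1..CARD('n)}" "step t = i"
    using step_surj by blast
  then show thesis
    using Some by (intro that[of t]) (auto simp: node_def)
qed

text \<open>Identifies columns with edge numbers, so that sums over columns become sums over the
  edge list.\<close>

lemma bij_betw_card_less:
  "bij_betw (\<lambda>c :: 'n::{finite,linorder}. card {s. s < c}) UNIV {..<CARD('n)}"
proof -
  have lt: "card {s. s < c} < card {s. s < c'}" if "c < c'" for c c' :: 'n
    using that by (intro psubset_card_mono) auto
  have "inj (\<lambda>c :: 'n. card {s. s < c})"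
    by (rule injI) (metis lt linorder_neq_iff)
  moreover have "card {s. s < c} < CARD('n)" for c :: 'n
    by (intro psubset_card_mono) auto
  ultimately show ?thesis
    unfolding bij_betw_def by (intro conjI card_subset_eq) (auto simp: card_image)
qed

lemma vector_incidence_nth:
  fixes x y :: "real ^ (('n::{finite,linorder}) option)" and c :: 'n
  defines "es \<equiv> edges CARD('n) (traj y)" and "k \<equiv> card {s. s < c}"
  shows "(x v* incidence y) $ c =
    (if k < length es then traj x (fst (es ! k)) - traj x (snd (es ! k)) else 0)"
proof (cases "k < length es")
  case True
  define a b :: "'n option" where "a = node (fst (es ! k))" and "b = node (snd (es ! k))"
  have "es ! k \<in> set es"
    using True by simp
  then have ab: "a \<noteq> b"
    using edges_valid[of "es ! k" "CARD('n)" "traj y"] by (simp add: a_def b_def es_def node_eq_iff)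
  \<comment> \<open>Since \<open>a \<noteq> b\<close>, the nested conditional of
    \<open>incidence\<close> splits into two separate indicators.\<close>
  have "(x v* incidence y) $ c = (\<Sum>v\<in>UNIV. (if v = a then x $ v else 0) - (if v = b then x $ v else 0))"
    unfolding vector_matrix_mult_def incidence_def es_def[symmetric]
    using True ab by (auto intro!: sum.cong simp: k_def a_def b_def)
  also have "\<dots> = x $ a - x $ b"
    by (simp add: sum_subtractf)
  finally show ?thesis
    using True by (simp add: a_def b_def traj_def)
next
  case False
  then show ?thesis
    unfolding vector_matrix_mult_def incidence_def es_def[symmetric] by (auto simp: k_def)
qed

text \<open>The quadratic form is the squared norm of \<open>x v* incidence x\<close>, whose entries
  are the half-cycle depths padded by zeros.\<close>

lemma cycling_cost_conv_edges:
  fixes x :: "real ^ (('n::{finite,linorder}) option)"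
  shows "cycling_cost \<alpha>\<^sub>b B E x =
    \<alpha>\<^sub>b * B * E / 2 * sum_list (map (edge_energy (traj x)) (edges CARD('n) (traj x)))"
proof -
  let ?es = "edges CARD('n) (traj x)"
  define f where "f k = (if k < length ?es then edge_energy (traj x) (?es ! k) else 0)" for k
  have "x \<bullet> (incidence x *v (transpose (incidence x) *v x)) = (x v* incidence x) \<bullet> (x v* incidence x)"
    by (simp add: dot_lmul_matrix)
  also have "\<dots> = (\<Sum>c\<in>UNIV. f (card {s :: 'n. s < c}))"
    unfolding inner_vec_def
    by (rule sum.cong) (auto simp: vector_incidence_nth f_def edge_energy_def power2_eq_square)
  also have "\<dots> = (\<Sum>k<CARD('n). f k)"
    using sum.reindex_bij_betw[OF bij_betw_card_less, of f] .
  also have "\<dots> = (\<Sum>k<length ?es. edge_energy (traj x) (?es ! k))"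
    using length_edges_le[of "CARD('n)" "traj x"]
    by (intro sum.mono_neutral_cong_right) (auto simp: f_def)
  also have "\<dots> = sum_list (map (edge_energy (traj x)) ?es)"
    by (simp add: sum_list_sum_nth lessThan_atLeast0)
  finally show ?thesis
    by (simp add: cycling_cost_def)
qed

text \<open>Full column rank excludes a zero column and two equal columns. Fewer than
  \<open>T\<close> edges would produce the former, a repeated edge the latter.\<close>

lemma zigzag_if_full_rank:
  fixes x :: "real ^ (('n::{finite,linorder}) option)"
  assumes "rank (incidence x) = CARD('n)"
  shows "zigzag CARD('n) (traj x)"
proof -
  let ?es = "edges CARD('n) (traj x)"
  have inj: "inj ((*v) (incidence x))"
    using assms by (simp add: full_rank_injective)
  have col: "incidence x *v axis c 1 = (\<chi> v. incidence x $ v $ c)" for c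
    by (simp add: matrix_vector_mult_basis column_def)
  have ex: "\<exists>c :: 'n. card {s. s < c} = k" if "k < CARD('n)" for k
  proof -
    have "k \<in> (\<lambda>c :: 'n. card {s. s < c}) ` UNIV"
      using that bij_betw_imp_surj_on[OF bij_betw_card_less[where 'n = 'n]] by simp
    then show ?thesis by auto
  qed
  have len: "length ?es = CARD('n)"
  proof (rule ccontr)
    assume "length ?es \<noteq> CARD('n)"
    then have "length ?es < CARD('n)"
      using length_edges_le[of "CARD('n)" "traj x"] by simp
    then obtain c :: 'n where "card {s. s < c} = length ?es"
      using ex by blast
    then have "incidence x *v axis c 1 = incidence x *v 0"
      unfolding col by (simp add: incidence_def Let_def vec_eq_iff)
    then have "axis c (1 :: real) = 0"
      using inj by (meson injD)
    then show False
      by (simp add: axis_eq_0_iff)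
  qed
  moreover have "distinct ?es"
    unfolding distinct_conv_nth
  proof (intro allI impI)
    fix i j assume ij: "i < length ?es" "j < length ?es" "i \<noteq> j"
    then obtain c c' :: 'n where c: "card {s. s < c} = i" "card {s. s < c'} = j"
      using ex len by metis
    show "?es ! i \<noteq> ?es ! j"
    proof
      assume "?es ! i = ?es ! j"
      then have "incidence x *v axis c 1 = incidence x *v axis c' 1"
        unfolding col using c ij by (simp add: incidence_def Let_def vec_eq_iff)
      then have "axis c (1 :: real) = axis c' 1"
        using inj by (meson injD)
      then have "c = c'"
        by (simp add: axis_eq_axis)
      then show False
        using c ij by simp
    qed
  qed
  ultimately show ?thesis
    by (intro zigzag_if_distinct_edges)
qed

section \<open>Behaviour along line segments\<close>

lemma sq_variation_add:
  "sq_variation T (\<lambda>t. x t + s * d t) =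
    sq_variation T x + 2 * s * (\<Sum>t\<in>{0<..T}. (x t - x (t - 1)) * (d t - d (t - 1))) + s\<^sup>2 * sq_variation T d"
proof -
  have *: "(a + s * b - (a' + s * b'))\<^sup>2
      = (a - a')\<^sup>2 + 2 * s * ((a - a') * (b - b')) + s\<^sup>2 * (b - b')\<^sup>2" for a b a' b' :: real
    by (simp add: power2_eq_square algebra_simps)
  show ?thesis
    unfolding sq_variation_def * by (simp only: sum.distrib sum_distrib_left)
qed

lemma sq_variation_eq_0_imp_const:
  assumes "sq_variation T x = 0" "t \<le> T"
  shows "x t = x 0"
proof -
  have "\<forall>t\<in>{0<..T}. (x t - x (t - 1))\<^sup>2 = 0"
    using assms(1) unfolding sq_variation_def by (subst (asm) sum_nonneg_eq_0_iff) auto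
  then have *: "x t = x (t - 1)" if "0 < t" "t \<le> T" for t
    using that by auto
  show ?thesis
    using assms(2)
  proof (induction t)
    case (Suc t)
    then show ?case using *[of "Suc t"] by simp
  qed simp
qed

text \<open>Finitely many strict inequalities between functions continuous in \<open>s\<close> hold
  at \<open>s = 0\<close>. In each disjunction the alternative that holds at \<open>0\<close>
  persists.\<close>

lemma zigzag_open:
  assumes "zigzag T x"
  shows "\<forall>\<^sub>F s in at_right 0. zigzag T (\<lambda>t. x t + s * d t)"
proof -
  have less: "\<forall>\<^sub>F s in at_right 0. f s < g s"
    if "(f \<longlongrightarrow> a) (at_right 0)" "(g \<longlongrightarrow> b) (at_right 0)" "a < b" for f g :: "real \<Rightarrow> real" and a b
  proof -
    have "\<forall>\<^sub>F s in at_right 0. 0 < g s - f s"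
      using that by (intro order_tendstoD(1)[OF tendsto_diff]) auto
    then show ?thesis
      by eventually_elim simp
  qed
  let ?y = "\<lambda>s t. x t + s * d t"
  have lim: "((\<lambda>s. ?y s i - ?y s j) \<longlongrightarrow> x i - x j) (at_right 0)" for i j
    by (auto intro!: tendsto_eq_intros)
  have "\<forall>\<^sub>F s in at_right 0. \<forall>t\<in>{1..<T}. (?y s t - ?y s (t - 1)) * (?y s (t + 1) - ?y s t) < 0"
    using assms unfolding zigzag_def
    by (intro eventually_ball_finite ballI less[OF tendsto_mult[OF lim lim] tendsto_const]) auto
  moreover have "\<forall>\<^sub>F s in at_right 0. \<forall>t\<in>{2..<T}. \<bar>?y s (t - 1) - ?y s (t - 2)\<bar> < \<bar>?y s t - ?y s (t - 1)\<bar> \<or>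
      \<bar>?y s (t + 1) - ?y s t\<bar> < \<bar>?y s t - ?y s (t - 1)\<bar>"
  proof (intro eventually_ball_finite ballI)
    fix t assume "t \<in> {2..<T}"
    then consider "\<bar>x (t - 1) - x (t - 2)\<bar> < \<bar>x t - x (t - 1)\<bar>" | "\<bar>x (t + 1) - x t\<bar> < \<bar>x t - x (t - 1)\<bar>"
      using assms unfolding zigzag_def by blast
    then show "\<forall>\<^sub>F s in at_right 0. \<bar>?y s (t - 1) - ?y s (t - 2)\<bar> < \<bar>?y s t - ?y s (t - 1)\<bar> \<or>
        \<bar>?y s (t + 1) - ?y s t\<bar> < \<bar>?y s t - ?y s (t - 1)\<bar>"
    proof cases
      case 1
      from less[OF tendsto_rabs[OF lim] tendsto_rabs[OF lim] this] show ?thesis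
        by (rule eventually_mono) simp
    next
      case 2
      from less[OF tendsto_rabs[OF lim] tendsto_rabs[OF lim] this] show ?thesis
        by (rule eventually_mono) simp
    qed
  qed simp
  ultimately show ?thesis
    unfolding zigzag_def by eventually_elim simp
qed

lemma traj_add_scaleR: "traj (x + s *\<^sub>R d) = (\<lambda>t. traj x t + s * traj d t)"
  by (auto simp: traj_def fun_eq_iff)

lemma cycling_cost_ge:
  fixes x :: "real ^ (('n::{finite,linorder}) option)"
  assumes "\<alpha>\<^sub>b * B * E / 2 \<ge> 0"
  shows "\<alpha>\<^sub>b * B * E / 2 * sq_variation CARD('n) (traj x) \<le> cycling_cost \<alpha>\<^sub>b B E x"
  unfolding cycling_cost_conv_edges by (intro mult_left_mono sq_variation_le_edges assms)

lemma cycling_cost_zigzag: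
  fixes x :: "real ^ (('n::{finite,linorder}) option)"
  assumes "zigzag CARD('n) (traj x)"
  shows "cycling_cost \<alpha>\<^sub>b B E x = \<alpha>\<^sub>b * B * E / 2 * sq_variation CARD('n) (traj x)"
  unfolding cycling_cost_conv_edges using sq_variation_eq_edges[OF assms] by simp

section \<open>The dispatch problem and its dual\<close>

text \<open>Division by \<open>s > 0\<close> and passage to the limit.\<close>

lemma first_order_nonneg:
  fixes a b :: real
  assumes "\<forall>\<^sub>F s in at_right 0. 0 \<le> s * a + s\<^sup>2 * b"
  shows "0 \<le> a"
proof -
  have "\<forall>\<^sub>F s in at_right 0. 0 \<le> a + s * b"
    using assms eventually_at_right_less[of 0]
  proof eventually_elim
    case (elim s)
    then have "0 \<le> s * (a + s * b)"
      by (simp add: power2_eq_square algebra_simps)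
    with elim(2) show ?case
      by (simp add: zero_le_mult_iff)
  qed
  moreover have "((\<lambda>s. a + s * b) \<longlongrightarrow> a) (at_right 0)"
    by (auto intro!: tendsto_eq_intros)
  ultimately show ?thesis
    by (intro tendsto_lowerbound) auto
qed

lemma gen_set_interior:
  fixes g v :: "real ^ 'n::finite"
  assumes "\<forall>t. g_lo < g $ t \<and> g $ t < g_hi"
  shows "\<forall>\<^sub>F s in at_right 0. g + s *\<^sub>R v \<in> gen_set g_lo g_hi"
proof -
  have "\<forall>\<^sub>F s in at_right 0. g_lo < g $ t + s * v $ t \<and> g $ t + s * v $ t < g_hi" for t
  proof -
    have "((\<lambda>s. g $ t + s * v $ t) \<longlongrightarrow> g $ t) (at_right 0)"
      by (auto intro!: tendsto_eq_intros)
    from order_tendstoD[OF this] show ?thesis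
      using assms by (intro eventually_conj) auto
  qed
  then have "\<forall>\<^sub>F s in at_right 0. \<forall>t. g_lo < g $ t + s * v $ t \<and> g $ t + s * v $ t < g_hi"
    by (rule eventually_all_finite)
  then show ?thesis
    by (rule eventually_mono) (auto simp: gen_set_def less_imp_le)
qed

text \<open>The gradient of \<open>gen_cost\<close> at \<open>g\<close>.\<close>

definition marginal_cost :: "real \<Rightarrow> real \<Rightarrow> real ^ 'n::finite \<Rightarrow> real ^ 'n" where
  "marginal_cost \<alpha>\<^sub>g \<beta>\<^sub>g g = (2 * \<alpha>\<^sub>g) *\<^sub>R g + \<beta>\<^sub>g *\<^sub>R 1"

lemma gen_cost_add:
  "gen_cost \<alpha>\<^sub>g \<beta>\<^sub>g (g + s *\<^sub>R v) =
    gen_cost \<alpha>\<^sub>g \<beta>\<^sub>g g + s * (marginal_cost \<alpha>\<^sub>g \<beta>\<^sub>g g \<bullet> v) + s\<^sup>2 * (\<alpha>\<^sub>g * (v \<bullet> v))"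
  by (simp add: gen_cost_def marginal_cost_def inner_simps inner_commute[of v g] power2_eq_square algebra_simps)

text \<open>Convexity, as all constraints are affine, parametrized by base point and direction to
  suit first-order conditions.\<close>

lemma storage_set_segment:
  assumes "(u, x) \<in> storage_set E u_lo u_hi x\<^sub>o" "(u', x') \<in> storage_set E u_lo u_hi x\<^sub>o" "0 \<le> s" "s \<le> 1"
  shows "(u + s *\<^sub>R (u' - u), x + s *\<^sub>R (x' - x)) \<in> storage_set E u_lo u_hi x\<^sub>o"
proof -
  have combination: "p + s * (q - p) = (1 - s) * p + s * q" for p q
    by (simp add: algebra_simps)
  have between: "a \<le> p \<Longrightarrow> a \<le> q \<Longrightarrow> a \<le> p + s * (q - p)" "p \<le> a \<Longrightarrow> q \<le> a \<Longrightarrow> p + s * (q - p) \<le> a"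
    for a p q
    unfolding combination
    using assms(3,4) convex_bound_le[of p a q "1 - s" s] convex_bound_le[of "- p" "- a" "- q" "1 - s" s]
    by simp_all
  have traj: "traj (x + s *\<^sub>R (x' - x)) t = traj x t + s * (traj x' t - traj x t)" for t
    by (simp add: traj_def)
  have nth: "(u + s *\<^sub>R (u' - u)) $ i = u $ i + s * (u' $ i - u $ i)" for i
    by simp
  have dyn: "p + s * (p' - p) = q + s * (q' - q) + (a + s * (a' - a)) / E"
    if "p = q + a / E" "p' = q' + a' / E" for p p' q q' a a'
    unfolding that by (simp add: add_divide_distrib diff_divide_distrib algebra_simps)
  show ?thesis
    using assms(1,2) unfolding storage_set_def mem_Collect_eq prod.case traj nth
    by (intro conjI ballI between dyn) simp_all
qed

text \<open>The difference of the trajectories is constant, and zero because both start at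
  \<open>x\<^sub>o\<close>. The dynamics then determine \<open>u\<close>.\<close>

lemma storage_set_eqI:
  fixes u u' :: "real ^ ('n::{finite,linorder})"
  assumes "(u, x) \<in> storage_set E u_lo u_hi x\<^sub>o" "(u', x') \<in> storage_set E u_lo u_hi x\<^sub>o" "E > 0"
    and "sq_variation CARD('n) (traj (x' - x)) = 0"
  shows "u' = u" "x' = x"
proof -
  have diff: "traj (x' - x) t = traj x' t - traj x t" for t
    by (simp add: traj_def)
  have "traj (x' - x) 0 = 0"
    using assms(1,2) by (simp add: diff storage_set_def)
  then have eq: "traj x' t = traj x t" if "t \<le> CARD('n)" for t
    using sq_variation_eq_0_imp_const[OF assms(4) that] diff[of t] by simp
  have "x' $ v = x $ v" for v
    using node_surj[of v] eq by (metis traj_def)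
  then show "x' = x"
    by (simp add: vec_eq_iff)
  have "u' $ i = u $ i" for i
  proof -
    obtain t where t: "t \<in> {1..CARD('n)}" "step t = i"
      using step_surj by blast
    then have "u' $ i / E = u $ i / E"
      using assms(1,2) eq[of t] eq[of "t - 1"] by (auto simp: storage_set_def)
    then show ?thesis
      using assms(3) by simp
  qed
  then show "u' = u"
    by (simp add: vec_eq_iff)
qed

text \<open>Minimality is tested on the segment towards \<open>(u, x)\<close>, with generation
  following the power balance. As \<open>g_opt\<close> is interior, the initial part of the segment
  respects the generation limits even if \<open>D + u\<close> does not. There \<open>C\<close>
  equals \<open>k * V\<close>, which yields a first-order inequality.\<close>

lemma storage_growth:
  fixes g_opt u_opt u D :: "real ^ ('n::{finite,linorder})" and C :: "real ^ ('n option) \<Rightarrow> real"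
    and k :: real
  defines "V \<equiv> \<lambda>x. sq_variation CARD('n) (traj x)"
  assumes C_ge: "\<And>x. k * V x \<le> C x" and C_opt: "C x_opt = k * V x_opt"
    and C_local: "\<And>d. \<forall>\<^sub>F s in at_right 0. C (x_opt + s *\<^sub>R d) = k * V (x_opt + s *\<^sub>R d)"
    and feasible: "(u_opt, x_opt) \<in> storage_set E u_lo u_hi x\<^sub>o" "D + u_opt = g_opt"
    and minimal: "\<And>g u x. g \<in> gen_set g_lo g_hi \<Longrightarrow> (u, x) \<in> storage_set E u_lo u_hi x\<^sub>o \<Longrightarrow> D + u = g \<Longrightarrow>
      gen_cost \<alpha>\<^sub>g \<beta>\<^sub>g g_opt + C x_opt \<le> gen_cost \<alpha>\<^sub>g \<beta>\<^sub>g g + C x"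
    and interior: "\<forall>t. g_lo < g_opt $ t \<and> g_opt $ t < g_hi"
    and ux: "(u, x) \<in> storage_set E u_lo u_hi x\<^sub>o"
  shows "C x_opt + marginal_cost \<alpha>\<^sub>g \<beta>\<^sub>g g_opt \<bullet> u_opt + k * V (x - x_opt)
    \<le> C x + marginal_cost \<alpha>\<^sub>g \<beta>\<^sub>g g_opt \<bullet> u"
proof -
  define v d where "v = u - u_opt" and "d = x - x_opt"
  define W where "W = (\<Sum>t\<in>{0<..CARD('n)}.
    (traj x_opt t - traj x_opt (t - 1)) * (traj d t - traj d (t - 1)))"
  let ?l = "marginal_cost \<alpha>\<^sub>g \<beta>\<^sub>g g_opt"
  have V: "V (x_opt + s *\<^sub>R d) = V x_opt + 2 * s * W + s\<^sup>2 * V d" for s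
    unfolding V_def traj_add_scaleR W_def by (rule sq_variation_add)
  have "\<forall>\<^sub>F s in at_right 0. (s::real) \<in> {0<..<1}"
    by (rule eventually_at_rightI[of 0 1]) auto
  then have "\<forall>\<^sub>F s in at_right 0. 0 \<le> s * (?l \<bullet> v + 2 * k * W) + s\<^sup>2 * (\<alpha>\<^sub>g * (v \<bullet> v) + k * V d)"
    using gen_set_interior[OF interior, of v] C_local[of d]
  proof eventually_elim
    case (elim s)
    have "(u_opt + s *\<^sub>R v, x_opt + s *\<^sub>R d) \<in> storage_set E u_lo u_hi x\<^sub>o"
      unfolding v_def d_def using elim(1) by (intro storage_set_segment feasible ux) auto
    then have "gen_cost \<alpha>\<^sub>g \<beta>\<^sub>g g_opt + C x_opt \<le> gen_cost \<alpha>\<^sub>g \<beta>\<^sub>g (g_opt + s *\<^sub>R v) + C (x_opt + s *\<^sub>R d)"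
      using feasible(2) by (intro minimal[OF elim(2)]) auto
    then show ?case
      unfolding elim(3) C_opt V gen_cost_add by (simp add: algebra_simps)
  qed
  then have "0 \<le> ?l \<bullet> v + 2 * k * W"
    by (rule first_order_nonneg)
  \<comment> \<open>At \<open>s = 1\<close> the expansion of \<open>V\<close> is still exact, and
    \<open>C\<close> lies above \<open>k * V\<close> even far from \<open>x_opt\<close>. The term
    \<open>k * V d\<close> is the surplus in the conclusion.\<close>
  moreover have "k * (V x_opt + 2 * W + V d) \<le> C x"
    using C_ge[of x] V[of 1] by (simp add: d_def)
  ultimately show ?thesis
    by (simp add: C_opt v_def d_def inner_diff_right algebra_simps)
qed

section \<open>Boundedness of the Lagrangian from below\<close>

lemma bounded_gen_set: "bounded (gen_set g_lo g_hi :: (real ^ 'n::finite) set)"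
proof -
  have "gen_set g_lo g_hi = cbox (\<chi> t. g_lo) (\<chi> t. g_hi :: real ^ 'n)"
    by (auto simp: gen_set_def mem_box_cart)
  then show ?thesis by simp
qed

text \<open>Needed to bound the infimum in the dual function by its value at a single point. The
  terms in \<open>g\<close> and \<open>u\<close> are bounded on boxes, and \<open>C\<close> is
  nonnegative.\<close>

lemma bdd_below_lagrangian:
  fixes l D :: "real ^ ('n::{finite,linorder})"
  assumes "\<And>x. 0 \<le> C x"
  shows "bdd_below ((\<lambda>(g, u, x). gen_cost \<alpha>\<^sub>g \<beta>\<^sub>g g + C x + l \<bullet> (D + u - g)) `
    (gen_set g_lo g_hi \<times> storage_set E u_lo u_hi x\<^sub>o))"
proof -
  \<comment> \<open>\<open>gen_set\<close> is reused as the box of storage powers.\<close>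
  have u_box: "u \<in> gen_set u_lo u_hi" if "(u, x) \<in> storage_set E u_lo u_hi x\<^sub>o" for u :: "real ^ ('n::{finite,linorder})" and x
  proof -
    have "u_lo \<le> u $ i \<and> u $ i \<le> u_hi" for i
      using step_surj[of i] that unfolding storage_set_def by blast
    then show ?thesis by (simp add: gen_set_def)
  qed
  obtain G U where G: "\<And>g :: real ^ ('n::{finite,linorder}). g \<in> gen_set g_lo g_hi \<Longrightarrow> norm g \<le> G"
    and U: "\<And>u :: real ^ ('n::{finite,linorder}). u \<in> gen_set u_lo u_hi \<Longrightarrow> norm u \<le> U"
    using bounded_gen_set unfolding bounded_iff by metis
  have "- \<bar>\<alpha>\<^sub>g\<bar> * G\<^sup>2 - \<bar>\<beta>\<^sub>g\<bar> * (norm (1 :: real ^ ('n::{finite,linorder})) * G) - norm l * (norm D + U + G)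
      \<le> gen_cost \<alpha>\<^sub>g \<beta>\<^sub>g g + C x + l \<bullet> (D + u - g)"
    if "g \<in> gen_set g_lo g_hi" "(u, x) \<in> storage_set E u_lo u_hi x\<^sub>o" for g u x
  proof -
    have g: "norm g \<le> G" and u: "norm u \<le> U"
      using G U u_box that by auto
    have "\<bar>\<alpha>\<^sub>g * (g \<bullet> g)\<bar> \<le> \<bar>\<alpha>\<^sub>g\<bar> * G\<^sup>2"
      using g by (simp add: abs_mult dot_square_norm mult_left_mono power_mono)
    moreover have "\<bar>\<beta>\<^sub>g * (1 \<bullet> g)\<bar> \<le> \<bar>\<beta>\<^sub>g\<bar> * (norm (1 :: real ^ ('n::{finite,linorder})) * G)"
      unfolding abs_mult
      using order_trans[OF Cauchy_Schwarz_ineq2[of 1 g] mult_left_mono[OF g]] by (simp add: mult_left_mono)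
    moreover have "norm (D + u - g) \<le> norm D + U + G"
      using norm_triangle_ineq4[of "D + u" g] norm_triangle_ineq[of D u] g u by linarith
    then have "\<bar>l \<bullet> (D + u - g)\<bar> \<le> norm l * (norm D + U + G)"
      by (intro order_trans[OF Cauchy_Schwarz_ineq2] mult_left_mono) auto
    ultimately show ?thesis
      using assms[of x] unfolding gen_cost_def by linarith
  qed
  then show ?thesis
    by (intro bdd_belowI2) (auto simp: split_beta)
qed

theorem theorem3:
  fixes \<alpha>\<^sub>g \<beta>\<^sub>g g_lo g_hi E u_lo u_hi x\<^sub>o B \<alpha>\<^sub>b :: real
    and D g_opt u_opt l_opt :: "real ^ ('n::{finite,linorder})"
    and x_opt :: "real ^ ('n option)"
  assumes "\<alpha>\<^sub>g > 0" and "\<beta>\<^sub>g > 0" and "g_lo \<le> g_hi" and "E > 0" and "u_lo \<le> u_hi"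
    and "x\<^sub>o \<in> {0..1}" and "B > 0" and "\<alpha>\<^sub>b > 0"
    and primal: "is_arg_min (\<lambda>(g, u, x). gen_cost \<alpha>\<^sub>g \<beta>\<^sub>g g + cycling_cost \<alpha>\<^sub>b B E x)
      (\<lambda>(g, u, x). g \<in> gen_set g_lo g_hi \<and> (u, x) \<in> storage_set E u_lo u_hi x\<^sub>o \<and> D + u = g)
      (g_opt, u_opt, x_opt)"
    and dual: "is_arg_max
      (dual_function \<alpha>\<^sub>g \<beta>\<^sub>g g_lo g_hi D (cycling_cost \<alpha>\<^sub>b B E) (storage_set E u_lo u_hi x\<^sub>o))
      (\<lambda>_. True) l_opt"
    and smooth: "\<exists>\<epsilon>>0. \<forall>y\<in>ball x_opt \<epsilon>. cycling_cost \<alpha>\<^sub>b B E differentiable at y"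
    and g_strict: "\<forall>t. g_lo < g_opt $ t \<and> g_opt $ t < g_hi"
    and x_strict: "\<forall>t. 0 < x_opt $ t \<and> x_opt $ t < 1"
    and u_strict: "\<forall>t. u_lo < u_opt $ t \<and> u_opt $ t < u_hi"
    and full_rank: "rank (incidence x_opt) = CARD('n)"
  shows "\<exists>!(z :: (real ^ ('n::{finite,linorder})) \<times> (real ^ ('n option))).
    is_arg_max (\<lambda>(u, x). - (l_opt \<bullet> u) - cycling_cost \<alpha>\<^sub>b B E x)
      (\<lambda>(u, x). (u, x) \<in> storage_set E u_lo u_hi x\<^sub>o) z"
proof -
  define C :: "real ^ ('n option) \<Rightarrow> real" where "C = cycling_cost \<alpha>\<^sub>b B E"
  define k where "k = \<alpha>\<^sub>b * B * E / 2"
  define V :: "real ^ ('n option) \<Rightarrow> real" where "V = (\<lambda>x. sq_variation CARD('n) (traj x))"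
  let ?G = "gen_set g_lo g_hi :: (real ^ ('n::{finite,linorder})) set"
    and ?S = "storage_set E u_lo u_hi x\<^sub>o :: ((real ^ ('n::{finite,linorder})) \<times> (real ^ ('n option))) set"
  let ?f = "gen_cost \<alpha>\<^sub>g \<beta>\<^sub>g :: real ^ ('n::{finite,linorder}) \<Rightarrow> real"
  define L where "L l = (\<lambda>(g, u, x). ?f g + C x + l \<bullet> (D + u - g))" for l
  define m where "m = marginal_cost \<alpha>\<^sub>g \<beta>\<^sub>g g_opt"
  have k: "k > 0"
    unfolding k_def using assms by simp
  have C_ge: "k * V x \<le> C x" for x
    unfolding C_def k_def V_def using k by (intro cycling_cost_ge) (simp add: k_def)
  have V_nonneg: "V x \<ge> 0" for x
    unfolding V_def sq_variation_def by (simp add: sum_nonneg)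
  have C_nonneg: "C x \<ge> 0" for x
    using C_ge[of x] V_nonneg[of x] k by (meson mult_nonneg_nonneg order_trans less_imp_le)
  have zz: "zigzag CARD('n) (traj x_opt)"
    using full_rank by (rule zigzag_if_full_rank)
  have C_opt: "C x_opt = k * V x_opt"
    unfolding C_def k_def V_def using zz by (rule cycling_cost_zigzag)
  \<comment> \<open>Openness of \<open>zigzag\<close> makes the cost agree with its convex minorant
    for small steps in any direction.\<close>
  have C_local: "\<forall>\<^sub>F s in at_right 0. C (x_opt + s *\<^sub>R d) = k * V (x_opt + s *\<^sub>R d)" for d
    using zigzag_open[OF zz, of "traj d"]
    by (rule eventually_mono) (simp add: C_def k_def V_def cycling_cost_zigzag traj_add_scaleR)
  have opt: "g_opt \<in> ?G" "(u_opt, x_opt) \<in> ?S" "D + u_opt = g_opt"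
    using primal unfolding is_arg_min_def by auto
  have minimal: "?f g_opt + C x_opt \<le> ?f g + C x" if "g \<in> ?G" "(u, x) \<in> ?S" "D + u = g" for g u x
    using primal that unfolding is_arg_min_def C_def by (auto simp: not_less)
  have growth: "C x_opt + m \<bullet> u_opt + k * V (x - x_opt) \<le> C x + m \<bullet> u" if "(u, x) \<in> ?S" for u x
    unfolding m_def V_def
    using C_ge C_opt C_local opt(2,3) minimal g_strict that unfolding V_def by (rule storage_growth)
  have dual_eq: "dual_function \<alpha>\<^sub>g \<beta>\<^sub>g g_lo g_hi D C ?S l = (INF p\<in>?G \<times> ?S. L l p)" for l
    by (simp add: dual_function_def L_def)
  \<comment> \<open>No duality gap at the multiplier \<open>m\<close>: the Lagrangian splits into a
    generation part, bounded by the exact expansion of the quadratic cost, and a storage part,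
    bounded by \<open>growth\<close>.\<close>
  have "?f g_opt + C x_opt \<le> dual_function \<alpha>\<^sub>g \<beta>\<^sub>g g_lo g_hi D C ?S m"
    unfolding dual_eq
  proof (rule cINF_greatest)
    show "?G \<times> ?S \<noteq> {}"
      using opt(1,2) by blast
    fix p assume "p \<in> ?G \<times> ?S"
    then obtain g u x where p: "p = (g, u, x)" "(u, x) \<in> ?S"
      by auto
    have "?f g = ?f g_opt + m \<bullet> (g - g_opt) + \<alpha>\<^sub>g * ((g - g_opt) \<bullet> (g - g_opt))"
      using gen_cost_add[of \<alpha>\<^sub>g \<beta>\<^sub>g g_opt 1 "g - g_opt"] by (simp add: m_def)
    moreover have "\<alpha>\<^sub>g * ((g - g_opt) \<bullet> (g - g_opt)) \<ge> 0" "k * V (x - x_opt) \<ge> 0"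
      using assms(1) k V_nonneg by simp_all
    moreover have "m \<bullet> (D + u - g) = m \<bullet> u - m \<bullet> u_opt - m \<bullet> (g - g_opt)"
      unfolding opt(3)[symmetric] by (simp add: inner_simps)
    ultimately show "?f g_opt + C x_opt \<le> L m p"
      using growth[OF p(2)] by (simp add: p(1) L_def)
  qed
  also have "\<dots> \<le> dual_function \<alpha>\<^sub>g \<beta>\<^sub>g g_lo g_hi D C ?S l_opt"
    using dual unfolding is_arg_max_def C_def by (simp add: not_less)
  finally have strong: "?f g_opt + C x_opt \<le> dual_function \<alpha>\<^sub>g \<beta>\<^sub>g g_lo g_hi D C ?S l_opt" .
  \<comment> \<open>Inserting the optimal storage schedule into the Lagrangian at
    \<open>l_opt\<close> leaves a problem in \<open>g\<close> alone, which \<open>g_opt\<close>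
    solves.\<close>
  have "?f g_opt + C x_opt \<le> ?f g + C x_opt + l_opt \<bullet> (g_opt - g)" if "g \<in> ?G" for g
  proof -
    have "dual_function \<alpha>\<^sub>g \<beta>\<^sub>g g_lo g_hi D C ?S l_opt \<le> L l_opt (g, u_opt, x_opt)"
      unfolding dual_eq L_def using opt that C_nonneg by (intro cINF_lower bdd_below_lagrangian) auto
    then show ?thesis
      using strong opt(3) by (simp add: L_def)
  qed
  then have g_min: "?f g_opt \<le> ?f g + l_opt \<bullet> (g_opt - g)" if "g \<in> ?G" for g
    using that by fastforce
  \<comment> \<open>The point \<open>g_opt\<close> minimizes \<open>?f g - l_opt \<bullet> g\<close>
    over the box and is interior, so no direction has negative slope. Along
    \<open>v = l_opt - m\<close> the slope is \<open>- (v \<bullet> v)\<close>.\<close>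
  have "l_opt = m"
  proof -
    define v where "v = l_opt - m"
    have "\<forall>\<^sub>F s in at_right 0. 0 \<le> s * (- (v \<bullet> v)) + s\<^sup>2 * (\<alpha>\<^sub>g * (v \<bullet> v))"
      using gen_set_interior[OF g_strict, of v]
    proof eventually_elim
      case (elim s)
      have "0 \<le> s * (m \<bullet> v) + s\<^sup>2 * (\<alpha>\<^sub>g * (v \<bullet> v)) - s * (l_opt \<bullet> v)"
        using g_min[OF elim] unfolding gen_cost_add by (simp add: m_def)
      also have "m \<bullet> v = l_opt \<bullet> v - v \<bullet> v"
        by (simp add: v_def inner_diff_left)
      finally show ?case
        by (simp add: algebra_simps)
    qed
    then have "0 \<le> - (v \<bullet> v)"
      by (rule first_order_nonneg)
    then have "\<not> 0 < v \<bullet> v"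
      by linarith
    then have "v = 0"
      by (simp only: inner_gt_zero_iff not_not)
    then show ?thesis
      by (simp add: v_def)
  qed
  with growth have growth': "C x_opt + l_opt \<bullet> u_opt + k * V (x - x_opt) \<le> C x + l_opt \<bullet> u"
    if "(u, x) \<in> ?S" for u x
    using that by simp
  show ?thesis
    unfolding C_def[symmetric]
  proof (rule ex1I)
    \<comment> \<open>Existence: dropping the nonnegative surplus shows that the dispatch schedule
      itself is a maximizer.\<close>
    have "\<not> - (l_opt \<bullet> u) - C x > - (l_opt \<bullet> u_opt) - C x_opt" if "(u, x) \<in> ?S" for u x
      using growth'[OF that] mult_nonneg_nonneg[OF less_imp_le[OF k] V_nonneg[of "x - x_opt"]] by linarith
    then show "is_arg_max (\<lambda>(u, x). - (l_opt \<bullet> u) - C x) (\<lambda>(u, x). (u, x) \<in> ?S) (u_opt, x_opt)"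
      using opt(2) unfolding is_arg_max_def by auto
  next
    fix z assume z: "is_arg_max (\<lambda>(u, x). - (l_opt \<bullet> u) - C x) (\<lambda>(u, x). (u, x) \<in> ?S) z"
    obtain u x where ux: "z = (u, x)" by (cases z)
    have S: "(u, x) \<in> ?S" and "\<not> - (l_opt \<bullet> u_opt) - C x_opt > - (l_opt \<bullet> u) - C x"
      using z opt(2) unfolding is_arg_max_def ux by auto
    \<comment> \<open>Uniqueness: a second maximizer leaves no room for the surplus.\<close>
    then have "k * V (x - x_opt) \<le> 0"
      using growth'[OF S] by linarith
    then have "V (x - x_opt) = 0"
      using k V_nonneg[of "x - x_opt"] by (simp add: mult_le_0_iff)
    then show "z = (u_opt, x_opt)"
      using storage_set_eqI[OF opt(2) S assms(4)] by (simp add: ux V_def)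
  qed
qed

end
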